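(* Let $r\geq3$ and $2\leq j\leq r-1$ be integers, let $-\pi<\phi<\pi$, and let $a,w_1,\ldots,w_r\in\mathcal{H}_{\phi}$ be fixed; put $\boldsymbol{w}=(w_1,\ldots,w_r)$. Let $R_q=\operatorname{Res}_{s=q}\zeta_r(s,a;\boldsymbol w)$ for $1\le q\le r$. Then, as $k\to\infty$, \[ \gamma_k(j,a;\boldsymbol w)=(-1)^kR_{j-1}-R_{j+1}+O(2^{-k}). \] In particular, \[ \lim_{n\to\infty}\gamma_{2n}(j,a;\boldsymbol w)=R_{j-1}-R_{j+1},\qquad \lim_{n\to\infty}\gamma_{2n+1}(j,a;\boldsymbol w)=-R_{j-1}-R_{j+1}. \] Both limits exist in $\mathbb C$. The full sequence $(\gamma_k(j,a;\boldsymbol w))_{k\ge0}$ converges if and only if $R_{j-1}=0$, in which case its limit is $-R_{j+1}$.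
   Context: For a fixed real number $-\pi<\phi<\pi$, $\mathcal{H}_{\phi}=\{\rho e^{i\theta}\in\mathbb{C}: \rho>0,\ \phi-\frac{\pi}{2}<\theta<\phi+\frac{\pi}{2}\}$ is an open half-plane. A fixed, otherwise arbitrary, holomorphic logarithm $\log$ on $\mathcal{H}_{\phi}$ is used throughout, with $z^s=\exp(s\log z)$ for $z\in\mathcal{H}_{\phi}$, $s\in\mathbb{C}$. For $a,w_1,\ldots,w_r\in\mathcal{H}_{\phi}$, the Barnes multiple zeta function is \[ \zeta_r(s,a;\boldsymbol{w})=\sum_{m_1=0}^{\infty}\cdots\sum_{m_r=0}^{\infty}(a+m_1w_1+\cdots+m_rw_r)^{-s}, \] which converges absolutely for $\operatorname{Re}s>r$ and continues meromorphically to all $s\in\mathbb{C}$, with only possible singularities simple poles at $s=1,\ldots,r$ (residues may be zero); the symbol $\zeta_r$ denotes the continued function. The Laurent coefficients at $s=j$ are defined by \[ \zeta_r(s,a;\boldsymbol{w})=\frac{R_j}{s-j}+\sum_{k=0}^\infty\gamma_k(j,a;\boldsymbol{w})(s-j)^k \] for $s$ near $j$, $s\neq j$. The constant implied by $O(2^{-k})$ may depend on $r$, $j$, the parameters $a,\boldsymbol w$ and the choice of logarithm, but not on $k$. *)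

theory Defs
  imports "HOL-Complex_Analysis.Complex_Analysis" "HOL-Library.Landau_Symbols"
begin

definition barnes_half_plane :: "real \<Rightarrow> complex set" where
  "barnes_half_plane \<phi> =
     {rcis \<rho> \<theta> | \<rho> \<theta>. \<rho> > 0 \<and> \<phi> - pi / 2 < \<theta> \<and> \<theta> < \<phi> + pi / 2}"

definition holomorphic_log_on :: "(complex \<Rightarrow> complex) \<Rightarrow> complex set \<Rightarrow> bool" where
  "holomorphic_log_on L H \<longleftrightarrow> L holomorphic_on H \<and> (\<forall>z\<in>H. exp (L z) = z)"

text \<open>
  The power \<open>z\<^sup>s\<close> with respect to a chosen logarithm \<open>L\<close>; the library's \<open>powr\<close> is tied to the
  principal branch.
\<close>
definition log_power :: "(complex \<Rightarrow> complex) \<Rightarrow> complex \<Rightarrow> complex \<Rightarrow> complex" where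
  "log_power L z s = exp (s * L z)"

text \<open>
  The parameters are \<open>w 1, \<dots>, w r\<close>, and a multi-index \<open>(m\<^sub>1, \<dots>, m\<^sub>r)\<close> is an extensional function
  on \<open>{1..r}\<close>. The series is only used for \<open>Re s > r\<close>, where it converges absolutely, so that the
  unordered sum agrees with the iterated one.
\<close>
definition barnes_series ::
  "(complex \<Rightarrow> complex) \<Rightarrow> nat \<Rightarrow> complex \<Rightarrow> (nat \<Rightarrow> complex) \<Rightarrow> complex \<Rightarrow> complex" where
  "barnes_series L r a w s =
     (\<Sum>\<^sub>\<infinity>m \<in> {1..r} \<rightarrow>\<^sub>E (UNIV :: nat set).
        log_power L (a + (\<Sum>i=1..r. of_nat (m i) * w i)) (- s))"

text \<open>
  The meromorphic continuation of the series to the whole plane. Being nicely meromorphic only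
  normalises the values at isolated points (the value 0 at poles, removable singularities
  removed), which makes the continuation unique as a total function. Nothing is prescribed
  about the location or the order of the poles.
\<close>
definition barnes_zeta ::
  "(complex \<Rightarrow> complex) \<Rightarrow> nat \<Rightarrow> complex \<Rightarrow> (nat \<Rightarrow> complex) \<Rightarrow> complex \<Rightarrow> complex" where
  "barnes_zeta L r a w =
     (THE Z. Z nicely_meromorphic_on UNIV \<and>
             (\<forall>s. Re s > real r \<longrightarrow> Z s = barnes_series L r a w s))"

definition barnes_residue ::
  "(complex \<Rightarrow> complex) \<Rightarrow> nat \<Rightarrow> complex \<Rightarrow> (nat \<Rightarrow> complex) \<Rightarrow> nat \<Rightarrow> complex" where
  "barnes_residue L r a w q = residue (barnes_zeta L r a w) (of_nat q)"

definition barnes_gamma ::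
  "(complex \<Rightarrow> complex) \<Rightarrow> nat \<Rightarrow> complex \<Rightarrow> (nat \<Rightarrow> complex) \<Rightarrow> nat \<Rightarrow> nat \<Rightarrow> complex" where
  "barnes_gamma L r a w j k =
     fls_nth (laurent_expansion (barnes_zeta L r a w) (of_nat j)) (int k)"

end

theory Submission
  imports Defs
begin

text \<open>
  Near \<open>s = j\<close> the asymptotics of the Laurent coefficients are governed by the other poles. Once it
  is known that, with an entire function \<open>E\<close>,
    \<open>\<zeta>(r, s) = E(s) + (\<Sum>q=1..r. R(q) / (s - q))\<close>,
  the \<open>k\<close>-th coefficient at \<open>j\<close> is the \<open>k\<close>-th Taylor coefficient of \<open>E\<close>, which is \<open>O(2^-k)\<close> by
  Cauchy's inequality on a circle of radius 2, minus the sum of \<open>R(q) / (q - j)^(k+1)\<close> over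
  \<open>q \<noteq> j\<close>. The two neighbours \<open>q = j - 1\<close> and \<open>q = j + 1\<close> contribute
  \<open>(-1)^k R(j - 1) - R(j + 1)\<close>; every other pole has distance at least 2 from \<open>j\<close> and contributes
  \<open>O(2^-k)\<close>.

  The main work is the continuation. It rests on a recurrence between the zeta functions
  themselves, without integral representations. Put \<open>v = w (r + 1)\<close>. Shifting every lattice point by
  \<open>v\<close> removes from \<open>\<zeta>(r + 1, s)\<close> exactly the terms with vanishing last index, that is
  \<open>\<zeta>(r, s)\<close>; on the other hand the shifted terms \<open>(z + v)^-s\<close> can be expanded by Taylor's formula
  in powers of \<open>v\<close>. Comparing both, the terms \<open>\<zeta>(r + 1, s)\<close> cancel, and
    \<open>s v \<zeta>(r + 1, s + 1) = \<zeta>(r, s) + Rem(N, s) + (\<Sum>k=2..N. (-s gchoose k) v^k \<zeta>(r + 1, s + k))\<close>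
  (lemma \<open>barnes_series_recurrence\<close>). The sum \<open>Rem(N, s)\<close> of the Taylor remainders converges on a
  half-plane that grows with \<open>N\<close>, and all values of \<open>\<zeta>(r + 1, _)\<close> on the right are taken at least
  one unit further to the right than the one on the left. So the formula continues \<open>\<zeta>(r + 1, _)\<close>
  to the left by one unit at a time.

  The poles are controlled by multiplying with \<open>(s - 1) \<dots> (s - r)\<close>, which is
  \<open>pochhammer (s - r) r\<close>: by the multiplicativity of Pochhammer symbols, the binomial coefficients on
  the right cancel all factors that the shift of the argument introduces
  (lemma \<open>pochhammer_gbinomial_cancel\<close>). Hence the product of \<open>\<zeta>(r, s)\<close> with this polynomial is
  entire, and the partial fraction formula above follows.
\<close>

section \<open>The half-plane and powers with respect to a logarithm\<close>

text \<open>
  Rotating by \<open>-\<phi>\<close> carries the half-plane to the right half-plane. The real part after the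
  rotation is additive and bounds the modulus from below, so it measures the size of lattice points
  without any cancellation.
\<close>
definition tilted_height :: "real \<Rightarrow> complex \<Rightarrow> real" where
  "tilted_height \<phi> z = Re (z * cis (- \<phi>))"

lemma tilted_height_add: "tilted_height \<phi> (x + y) = tilted_height \<phi> x + tilted_height \<phi> y"
  by (simp add: tilted_height_def distrib_right)

lemma tilted_height_of_real_mult: "tilted_height \<phi> (of_real t * x) = t * tilted_height \<phi> x"
  by (simp add: tilted_height_def mult.assoc)

lemma tilted_height_of_nat_mult: "tilted_height \<phi> (of_nat n * x) = real n * tilted_height \<phi> x"
  using tilted_height_of_real_mult[of \<phi> "real n" x] by simp

lemma tilted_height_sum: "tilted_height \<phi> (\<Sum>i\<in>A. f i) = (\<Sum>i\<in>A. tilted_height \<phi> (f i))"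
  by (simp add: tilted_height_def sum_distrib_right)

lemma tilted_height_le_norm: "tilted_height \<phi> z \<le> norm z"
  unfolding tilted_height_def using complex_Re_le_cmod[of "z * cis (-\<phi>)"] by (simp add: norm_mult)

lemma barnes_half_plane_eq: "barnes_half_plane \<phi> = {z. tilted_height \<phi> z > 0}"
proof (intro equalityI subsetI)
  fix z assume "z \<in> barnes_half_plane \<phi>"
  then obtain \<rho> \<theta> where z: "z = rcis \<rho> \<theta>" "\<rho> > 0" "\<phi> - pi / 2 < \<theta>" "\<theta> < \<phi> + pi / 2"
    by (auto simp: barnes_half_plane_def)
  have "z * cis (- \<phi>) = rcis \<rho> (\<theta> - \<phi>)"
    by (simp add: z rcis_def cis_mult)
  moreover have "cos (\<theta> - \<phi>) > 0"
    using z by (intro cos_gt_zero_pi) auto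
  hence "Re (rcis \<rho> (\<theta> - \<phi>)) > 0"
    using z by simp
  ultimately show "z \<in> {z. tilted_height \<phi> z > 0}"
    by (simp only: tilted_height_def mem_Collect_eq)
next
  fix z assume "z \<in> {z. tilted_height \<phi> z > 0}"
  then have pos: "Re (z * cis (- \<phi>)) > 0"
    by (simp add: tilted_height_def)
  define u where "u = z * cis (- \<phi>)"
  have "u \<noteq> 0" "\<bar>Arg u\<bar> < pi / 2"
    using pos Arg_Re_pos[of u] by (auto simp: u_def[symmetric] simp del: times_complex.sel)
  moreover have "z = u * cis \<phi>"
    by (simp add: u_def mult.assoc cis_mult)
  hence "z = rcis (norm u) (Arg u + \<phi>)"
    by (metis rcis_cmod_Arg rcis_def cis_mult mult.assoc)
  ultimately show "z \<in> barnes_half_plane \<phi>"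
    unfolding barnes_half_plane_def
    by (intro CollectI exI[of _ "norm u"] exI[of _ "Arg u + \<phi>"]) auto
qed

lemma open_barnes_half_plane: "open (barnes_half_plane \<phi>)"
  unfolding barnes_half_plane_eq tilted_height_def
  by (intro open_Collect_less continuous_intros)

lemma convex_barnes_half_plane: "convex (barnes_half_plane \<phi>)"
proof (rule convexI)
  fix x y and u v :: real
  assume *: "x \<in> barnes_half_plane \<phi>" "y \<in> barnes_half_plane \<phi>" "0 \<le> u" "0 \<le> v" "u + v = 1"
  have "0 < u * tilted_height \<phi> x + v * tilted_height \<phi> y"
    using * by (cases "u = 0") (auto simp: barnes_half_plane_eq intro: add_pos_nonneg)
  thus "u *\<^sub>R x + v *\<^sub>R y \<in> barnes_half_plane \<phi>"
    by (simp add: barnes_half_plane_eq scaleR_conv_of_real tilted_height_add tilted_height_of_real_mult)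
qed

locale half_plane_log =
  fixes \<phi> :: real and L :: "complex \<Rightarrow> complex"
  assumes log: "holomorphic_log_on L (barnes_half_plane \<phi>)"
begin

abbreviation H :: "complex set" where "H \<equiv> barnes_half_plane \<phi>"
abbreviation ht :: "complex \<Rightarrow> real" where "ht \<equiv> tilted_height \<phi>"
abbreviation pow :: "complex \<Rightarrow> complex \<Rightarrow> complex" where "pow \<equiv> log_power L"

lemma exp_L: "z \<in> H \<Longrightarrow> exp (L z) = z"
  using log by (auto simp: holomorphic_log_on_def)

lemma nonzero: "z \<in> H \<Longrightarrow> z \<noteq> 0"
  using exp_L exp_not_eq_zero by metis

lemma L_has_derivative: 
  assumes "z \<in> H"
  shows   "(L has_field_derivative 1 / z) (at z)"
proof -
  obtain D where D: "(L has_field_derivative D) (at z)"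
    using log assms open_barnes_half_plane
    by (auto simp: holomorphic_log_on_def holomorphic_on_open)
  have "((\<lambda>z. exp (L z)) has_field_derivative exp (L z) * D) (at z)"
    by (rule DERIV_fun_exp[OF D])
  moreover have "((\<lambda>z. exp (L z)) has_field_derivative 1) (at z)"
    by (rule has_field_derivative_transform_within_open[OF DERIV_ident open_barnes_half_plane assms])
       (simp add: exp_L)
  ultimately have "exp (L z) * D = 1"
    by (rule DERIV_unique)
  hence "D = 1 / z"
    using exp_L[OF assms] nonzero[OF assms] by (simp add: field_simps)
  with D show ?thesis by simp
qed

text \<open>
  The modulus of \<open>z^s\<close> is \<open>norm z powr Re s\<close> up to the factor \<open>exp (- Im s Im (L z))\<close>; this bound makes that
  factor harmless, whichever logarithm was chosen.
\<close>
lemma Im_L_bounded: "\<exists>B\<ge>0. \<forall>z\<in>H. \<bar>Im (L z)\<bar> \<le> B"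
proof -
  define D where "D = (\<lambda>z. L z - Ln (z * cis (-\<phi>)))"
  \<comment> \<open>After the rotation the principal branch is available on the whole half-plane, and two
      logarithms on a connected set differ by a constant.\<close>
  have "(D has_field_derivative 0) (at z within H)" if z: "z \<in> H" for z
  proof -
    have "z * cis (-\<phi>) \<notin> \<real>\<^sub>\<le>\<^sub>0"
      using z by (auto simp: barnes_half_plane_eq tilted_height_def complex_nonpos_Reals_iff)
    thus ?thesis unfolding D_def using nonzero[OF z]
      by (auto intro!: derivative_eq_intros has_field_derivative_at_within[OF L_has_derivative[OF z]]
               simp: field_simps)
  qed
  then obtain c where c: "\<And>z. z \<in> H \<Longrightarrow> D z = c"
    using has_field_derivative_zero_constant[OF convex_barnes_half_plane] by metis
  have "\<bar>Im (L z)\<bar> \<le> \<bar>Im c\<bar> + pi" if z: "z \<in> H" for z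
  proof -
    have "L z = c + Ln (z * cis (-\<phi>))"
      using c[OF z] by (simp add: D_def algebra_simps)
    moreover have "z * cis (-\<phi>) \<noteq> 0" using nonzero[OF z] by simp
    ultimately show ?thesis
      using mpi_less_Im_Ln[of "z * cis (-\<phi>)"] Im_Ln_le_pi[of "z * cis (-\<phi>)"] by simp
  qed
  thus ?thesis by (intro exI[of _ "\<bar>Im c\<bar> + pi"]) auto
qed

lemma norm_pow:
  assumes "z \<in> H"
  shows   "norm (pow z s) = norm z powr Re s * exp (- (Im s * Im (L z)))"
proof -
  have "norm z = exp (Re (L z))"
    by (metis norm_exp_eq_Re exp_L[OF assms])
  hence "norm z powr Re s = exp (Re s * Re (L z))"
    by (simp add: powr_def)
  thus ?thesis
    by (simp add: log_power_def exp_diff exp_minus field_simps)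
qed

lemma pow_has_derivative:
  assumes "z \<in> H"
  shows   "((\<lambda>z. pow z s) has_field_derivative s * pow z (s - 1)) (at z)"
proof -
  have "((\<lambda>z. pow z s) has_field_derivative exp (s * L z) * (s * (1 / z))) (at z)"
    unfolding log_power_def
    by (auto intro!: derivative_eq_intros L_has_derivative assms)
  also have "exp (s * L z) * (s * (1 / z)) = s * pow z (s - 1)"
    using nonzero[OF assms] by (simp add: log_power_def algebra_simps exp_diff exp_L[OF assms])
  finally show ?thesis .
qed

lemma pow_holomorphic: "f holomorphic_on A \<Longrightarrow> (\<lambda>s. pow z (f s)) holomorphic_on A"
  unfolding log_power_def by (intro holomorphic_intros)

text \<open>
  A bound by a power of \<open>n\<close> that is uniform for \<open>s\<close> in a bounded set, which is what a locally
  uniform majorant of the lattice sums needs.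
\<close>
lemma pow_bound:
  assumes "0 < c" "c \<le> 1" "0 \<le> \<tau>"
  shows   "\<exists>C\<ge>0. \<forall>z\<in>H. \<forall>n\<ge>1. \<forall>s. c * n \<le> norm z \<longrightarrow> \<tau> \<le> Re s \<longrightarrow> norm s \<le> T \<longrightarrow>
             norm (pow z (- s)) \<le> C * n powr (- \<tau>)"
proof -
  obtain B where B: "B \<ge> 0" "\<And>z. z \<in> H \<Longrightarrow> \<bar>Im (L z)\<bar> \<le> B"
    using Im_L_bounded by auto
  have "norm (pow z (- s)) \<le> exp (T * B) * c powr (- T) * n powr (- \<tau>)"
    if z: "z \<in> H" and n: "n \<ge> 1" "c * n \<le> norm z" and s: "\<tau> \<le> Re s" "norm s \<le> T" for z s n
  proof -
    have Re: "Re s \<le> T" "\<bar>Im s\<bar> \<le> T"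
      using s complex_Re_le_cmod[of s] abs_Im_le_cmod[of s] by linarith+
    have "norm z powr (- Re s) \<le> (c * n) powr (- Re s)"
      using n s assms by (intro powr_mono2') auto
    also have "\<dots> = c powr (- Re s) * n powr (- Re s)"
      using assms n by (simp add: powr_mult)
    also have "\<dots> \<le> c powr (- T) * n powr (- \<tau>)"
      using assms n s Re by (intro mult_mono powr_mono powr_mono') auto
    finally have 1: "norm z powr (- Re s) \<le> c powr (- T) * n powr (- \<tau>)" .
    have "Im s * Im (L z) \<le> \<bar>Im s\<bar> * \<bar>Im (L z)\<bar>"
      by (metis abs_ge_self abs_mult)
    also have "\<dots> \<le> T * B"
      using Re B z by (intro mult_mono) auto
    finally have 2: "exp (Im s * Im (L z)) \<le> exp (T * B)" by simp
    have "norm (pow z (- s)) = norm z powr (- Re s) * exp (Im s * Im (L z))"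
      using norm_pow[OF z, of "-s"] by simp
    also have "\<dots> \<le> (c powr (- T) * n powr (- \<tau>)) * exp (T * B)"
      by (intro mult_mono 1 2) auto
    finally show ?thesis by (simp add: mult_ac)
  qed
  thus ?thesis
    by (intro exI[of _ "exp (T * B) * c powr (- T)"]) auto
qed

end

section \<open>Holomorphy and convergence of lattice sums\<close>

text \<open>
  Weierstrass' theorem for unordered sums: a summable majorant near each point gives uniform
  convergence of the finite partial sums on a small closed disc.
\<close>
lemma holomorphic_infsum:
  fixes f :: "'a \<Rightarrow> complex \<Rightarrow> complex"
  assumes U: "open U"
  assumes holo: "\<And>x. x \<in> X \<Longrightarrow> f x holomorphic_on U"
  assumes bound: "\<And>s0. s0 \<in> U \<Longrightarrow> \<exists>\<epsilon>>0. \<exists>M. M summable_on X \<and>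
                    (\<forall>x\<in>X. \<forall>s\<in>U. dist s0 s \<le> \<epsilon> \<longrightarrow> norm (f x s) \<le> M x)"
  shows   "(\<lambda>s. \<Sum>\<^sub>\<infinity>x\<in>X. f x s) holomorphic_on U"
proof -
  have "(\<lambda>s. \<Sum>\<^sub>\<infinity>x\<in>X. f x s) field_differentiable (at s0)" if s0: "s0 \<in> U" for s0
  proof -
    obtain \<epsilon> M where \<epsilon>: "\<epsilon> > 0" and M: "M summable_on X"
        "\<And>x s. x \<in> X \<Longrightarrow> s \<in> U \<Longrightarrow> dist s0 s \<le> \<epsilon> \<Longrightarrow> norm (f x s) \<le> M x"
      using bound[OF s0] by blast
    obtain \<delta>' where \<delta>': "\<delta>' > 0" "cball s0 \<delta>' \<subseteq> U"
      using U s0 open_contains_cball by blast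
    define \<delta> where "\<delta> = min \<epsilon> \<delta>'"
    have \<delta>: "\<delta> > 0" "\<delta> \<le> \<epsilon>" "cball s0 \<delta> \<subseteq> U"
      using \<epsilon> \<delta>' by (auto simp: \<delta>_def)
    have lim: "uniform_limit (cball s0 \<delta>) (\<lambda>Y s. \<Sum>x\<in>Y. f x s) (\<lambda>s. \<Sum>\<^sub>\<infinity>x\<in>X. f x s)
                 (finite_subsets_at_top X)"
      by (rule Weierstrass_m_test_general[OF _ M(1)]) (use M(2) \<delta> in auto)
    have "(\<lambda>s. \<Sum>x\<in>Y. f x s) holomorphic_on cball s0 \<delta>" if "Y \<subseteq> X" for Y
      using that by (intro holomorphic_on_sum holomorphic_on_subset[OF holo \<delta>(3)]) auto
    hence "\<forall>\<^sub>F Y in finite_subsets_at_top X. continuous_on (cball s0 \<delta>) (\<lambda>s. \<Sum>x\<in>Y. f x s) \<and>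
             (\<lambda>s. \<Sum>x\<in>Y. f x s) holomorphic_on ball s0 \<delta>"
      by (intro eventually_finite_subsets_at_top_weakI conjI holomorphic_on_imp_continuous_on)
         (auto intro: holomorphic_on_subset[OF _ ball_subset_cball])
    from holomorphic_uniform_limit[OF this lim] \<delta>(1)
    have "(\<lambda>s. \<Sum>\<^sub>\<infinity>x\<in>X. f x s) holomorphic_on ball s0 \<delta>"
      by auto
    with \<delta>(1) show ?thesis
      by (meson centre_in_ball holomorphic_on_imp_differentiable_at open_ball)
  qed
  thus ?thesis
    by (auto simp: holomorphic_on_def intro: field_differentiable_at_within)
qed

definition multi_indices :: "nat \<Rightarrow> (nat \<Rightarrow> nat) set" where
  "multi_indices r = {1..r} \<rightarrow>\<^sub>E UNIV"

definition index_size :: "nat \<Rightarrow> (nat \<Rightarrow> nat) \<Rightarrow> real" where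
  "index_size r m = 1 + (\<Sum>i=1..r. real (m i))"

definition lattice_point :: "nat \<Rightarrow> complex \<Rightarrow> (nat \<Rightarrow> complex) \<Rightarrow> (nat \<Rightarrow> nat) \<Rightarrow> complex" where
  "lattice_point r a w m = a + (\<Sum>i=1..r. of_nat (m i) * w i)"

lemma barnes_series_eq:
  "barnes_series L r a w s = (\<Sum>\<^sub>\<infinity>m\<in>multi_indices r. log_power L (lattice_point r a w m) (- s))"
  by (simp add: barnes_series_def multi_indices_def lattice_point_def)

lemma index_size_ge_1: "index_size r m \<ge> 1"
  by (simp add: index_size_def sum_nonneg)

text \<open>
  Since each \<open>1 + m\<^sub>i\<close> is at most the index size, the power \<open>-\<tau>\<close> of the size is dominated by the
  product over \<open>i\<close> of \<open>(1 + m\<^sub>i) powr (-p)\<close> with \<open>p = \<tau> / r > 1\<close>, and the sum of these products factorises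
  into convergent one-dimensional series.
\<close>
lemma summable_on_multi_indices:
  assumes "\<tau> > real r"
  shows   "(\<lambda>m. index_size r m powr (- \<tau>)) summable_on multi_indices r"
proof (cases "r = 0")
  case True
  thus ?thesis by (simp add: multi_indices_def)
next
  case False
  define p where "p = \<tau> / real r"
  have p: "p > 1" using assms False by (simp add: p_def)
  have "summable (\<lambda>n. real n powr (- p))"
    using p by (subst summable_real_powr_iff) auto
  hence "summable (\<lambda>n. real (Suc n) powr (- p))"
    by (subst summable_Suc_iff)
  hence "(\<lambda>n. real (Suc n) powr (- p)) summable_on UNIV"
    by (subst summable_on_UNIV_nonneg_real_iff) auto
  hence "Infinite_Sum.abs_summable_on (\<lambda>n. real (Suc n) powr (- p)) UNIV"
    by (simp only: summable_on_iff_abs_summable_on_real[symmetric])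
  hence "Infinite_Sum.abs_summable_on (\<lambda>m. \<Prod>i\<in>{1..r}. real (Suc (m i)) powr (- p)) (multi_indices r)"
    unfolding multi_indices_def abs_summable_equivalent
    by (intro abs_summable_on_prod_PiE) auto
  hence "Infinite_Sum.abs_summable_on (\<lambda>m. index_size r m powr (- \<tau>)) (multi_indices r)"
  proof (rule Infinite_Sum.abs_summable_on_comparison_test)
    fix m assume "m \<in> multi_indices r"
    have "index_size r m powr (- \<tau>) = (index_size r m powr (- p)) ^ r"
      using index_size_ge_1[of r m] False
      by (simp add: powr_power p_def)
    also have "\<dots> = (\<Prod>i\<in>{1..r}. index_size r m powr (- p))"
      by simp
    also have "\<dots> \<le> (\<Prod>i\<in>{1..r}. real (Suc (m i)) powr (- p))"
    proof (intro prod_mono conjI powr_mono2')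
      fix i assume "i \<in> {1..r}"
      hence "real (m i) \<le> (\<Sum>i=1..r. real (m i))"
        by (intro member_le_sum) auto
      thus "real (Suc (m i)) \<le> index_size r m"
        by (simp add: index_size_def)
    qed (use p in auto)
    finally show "norm (index_size r m powr (- \<tau>)) \<le>
                  norm (\<Prod>i\<in>{1..r}. real (Suc (m i)) powr (- p))"
      by (simp add: abs_prod)
  qed
  thus ?thesis
    by (simp only: summable_on_iff_abs_summable_on_real[symmetric])
qed

lemma lattice_point_height:
  assumes "a \<in> barnes_half_plane \<phi>" "\<forall>i\<in>{1..r}. w i \<in> barnes_half_plane \<phi>"
  shows   "\<exists>c>0. c \<le> 1 \<and> (\<forall>m. c * index_size r m \<le> tilted_height \<phi> (lattice_point r a w m))"
proof -
  define S where "S = insert 1 (insert (tilted_height \<phi> a) ((\<lambda>i. tilted_height \<phi> (w i)) ` {1..r}))"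
  define c where "c = Min S"
  have S: "finite S" "S \<noteq> {}" "\<forall>x\<in>S. x > 0"
    using assms by (auto simp: S_def barnes_half_plane_eq)
  have c: "c > 0" "c \<le> 1" "c \<le> tilted_height \<phi> a" "\<And>i. i \<in> {1..r} \<Longrightarrow> c \<le> tilted_height \<phi> (w i)"
    using S unfolding c_def by (auto intro!: Min_le) (auto simp: S_def)
  have "c * index_size r m \<le> tilted_height \<phi> (lattice_point r a w m)" for m
  proof -
    have "c * index_size r m = c + (\<Sum>i=1..r. real (m i) * c)"
      by (simp add: index_size_def distrib_left sum_distrib_left mult_ac)
    also have "\<dots> \<le> tilted_height \<phi> a + (\<Sum>i=1..r. real (m i) * tilted_height \<phi> (w i))"
      using c by (intro add_mono sum_mono mult_left_mono) auto
    also have "\<dots> = tilted_height \<phi> (lattice_point r a w m)"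
      by (simp add: lattice_point_def tilted_height_add tilted_height_sum tilted_height_of_nat_mult)
    finally show ?thesis .
  qed
  with c show ?thesis by blast
qed

lemma gbinomial_uminus_holomorphic: "(\<lambda>s. (- s) gchoose n) holomorphic_on (A :: complex set)"
  unfolding gbinomial_pochhammer by (intro holomorphic_intros) auto

context half_plane_log
begin

lemma lattice_point_in_H:
  assumes "a \<in> H" "\<forall>i\<in>{1..r}. w i \<in> H"
  shows   "lattice_point r a w m \<in> H"
proof -
  obtain c where c: "c > 0" "c * index_size r m \<le> ht (lattice_point r a w m)"
    using lattice_point_height[OF assms] by blast
  have "0 < c * index_size r m"
    using c index_size_ge_1[of r m] by (intro mult_pos_pos) auto
  with c show ?thesis by (auto simp: barnes_half_plane_eq)
qed

definition Taylor_remainder :: "complex \<Rightarrow> nat \<Rightarrow> complex \<Rightarrow> complex \<Rightarrow> complex" where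
  "Taylor_remainder v N z s =
     pow (z + v) (- s) - (\<Sum>k\<le>N. ((- s) gchoose k) * v ^ k * pow z (- s - of_nat k))"

text \<open>
  The derivative of order \<open>N + 1\<close> of \<open>z^-s\<close> in \<open>z\<close> is a multiple of \<open>z^(-s-N-1)\<close>. On the segment from
  \<open>z\<close> to \<open>z + v\<close> the tilted height only increases, so the remainder decays like the
  power of order \<open>-(Re s + N + 1)\<close> of the height of \<open>z\<close>. This gain of \<open>N + 1\<close> is what drives the
  continuation.
\<close>
lemma Taylor_remainder_bound:
  assumes c: "0 < c" "c \<le> 1" and \<tau>: "0 \<le> \<tau>" and v: "v \<in> H"
  shows "\<exists>K. \<forall>z\<in>H. \<forall>n\<ge>1. \<forall>s. c * n \<le> ht z \<longrightarrow> \<tau> \<le> Re s + real N + 1 \<longrightarrow> norm s \<le> T \<longrightarrow>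
           norm (Taylor_remainder v N z s) \<le> K * n powr (- \<tau>)"
proof -
  obtain C where C: "C \<ge> 0" "\<And>z n s. z \<in> H \<Longrightarrow> n \<ge> 1 \<Longrightarrow> c * n \<le> norm z \<Longrightarrow> \<tau> \<le> Re s \<Longrightarrow>
      norm s \<le> T + real N + 1 \<Longrightarrow> norm (pow z (- s)) \<le> C * n powr (- \<tau>)"
    using pow_bound[OF c \<tau>, of "T + real N + 1"] by blast
  have "compact ((\<lambda>s. (- s) gchoose Suc N) ` cball (0::complex) T)"
    by (intro compact_continuous_image holomorphic_on_imp_continuous_on
              gbinomial_uminus_holomorphic compact_cball)
  then obtain G where "\<forall>s\<in>cball 0 T. norm ((- s) gchoose Suc N :: complex) \<le> G"
    by (auto dest!: compact_imp_bounded simp: bounded_iff)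
  hence G: "\<And>s. norm s \<le> T \<Longrightarrow> norm ((- s) gchoose Suc N :: complex) \<le> G"
    by (simp add: dist_norm)
  define f where "f = (\<lambda>s i x. fact i * ((- s) gchoose i) * pow x (- s - of_nat i))"
  have bound: "norm (Taylor_remainder v N z s) \<le> (fact (Suc N) * G * C * norm v ^ Suc N / fact N) * n powr (- \<tau>)"
    if z: "z \<in> H" "c * n \<le> ht z" and n: "n \<ge> 1" and s: "\<tau> \<le> Re s + real N + 1" "norm s \<le> T" 
    for z n s
  proof -
    have seg: "x \<in> H \<and> c * n \<le> norm x" if x: "x \<in> closed_segment z (z + v)" for x
    proof -
      obtain t where t: "0 \<le> t" "x = z + of_real t * v"
        using x by (auto simp: in_segment scaleR_conv_of_real algebra_simps)
      have "ht x \<ge> ht z"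
        using t v by (simp add: tilted_height_add tilted_height_of_real_mult barnes_half_plane_eq)
      thus ?thesis
        using z tilted_height_le_norm[of \<phi> x] by (auto simp: barnes_half_plane_eq)
    qed
    have deriv: "(f s i has_field_derivative f s (Suc i) x) (at x within closed_segment z (z + v))"
      if "x \<in> closed_segment z (z + v)" for i x
    proof -
      have "(f s i has_field_derivative fact i * ((- s) gchoose i) *
               ((- s - of_nat i) * pow x (- s - of_nat i - 1))) (at x within closed_segment z (z + v))"
        unfolding f_def
        by (rule DERIV_cmult[OF has_field_derivative_at_within[OF pow_has_derivative[OF conjunct1[OF seg[OF that]]]]])
      also have "fact i * ((- s) gchoose i) * ((- s - of_nat i) * pow x (- s - of_nat i - 1))
                   = f s (Suc i) x"
      proof -
        have "fact (Suc i) * ((- s) gchoose Suc i) = fact i * ((- s) gchoose i) * (- s - of_nat i)"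
          using of_nat_neq_0[of i, where 'a = complex] by (simp add: gbinomial_prod_rev)
        moreover have "- s - of_nat (Suc i) = - s - of_nat i - 1"
          by simp
        ultimately show ?thesis by (simp only: f_def mult.assoc[symmetric])
      qed
      finally show ?thesis .
    qed
    have "norm (f s 0 (z + v) - (\<Sum>i\<le>N. f s i z * (z + v - z) ^ i / fact i)) \<le>
            (fact (Suc N) * G * (C * n powr (- \<tau>))) * norm (z + v - z) ^ Suc N / fact N"
    proof (rule complex_Taylor[OF convex_closed_segment[of z "z + v"]])
      show "(f s i has_field_derivative f s (Suc i) x) (at x within closed_segment z (z + v))"
        if "x \<in> closed_segment z (z + v)" for i x
        using deriv that .
      show "norm (f s (Suc N) x) \<le> fact (Suc N) * G * (C * n powr (- \<tau>))"
        if "x \<in> closed_segment z (z + v)" for x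
      proof -
        have "norm (s + of_nat (Suc N)) \<le> norm s + norm (of_nat (Suc N) :: complex)"
          by (rule norm_triangle_ineq)
        also have "norm (of_nat (Suc N) :: complex) = real (Suc N)"
          by (rule norm_of_nat)
        finally have "norm (s + of_nat (Suc N)) \<le> T + real N + 1"
          using s by simp
        hence "norm (pow x (- (s + of_nat (Suc N)))) \<le> C * n powr (- \<tau>)"
          using s seg[OF that] n by (intro C(2)) auto
        moreover have "norm (f s (Suc N) x) =
            fact (Suc N) * norm ((- s) gchoose Suc N) * norm (pow x (- (s + of_nat (Suc N))))"
          by (simp only: f_def norm_mult norm_fact minus_add_distrib diff_conv_add_uminus)
        ultimately show ?thesis
          using G[OF s(2)] by (auto intro!: mult_mono order_trans[OF norm_ge_zero G[OF s(2)]])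
      qed
    qed auto
    also have "f s 0 (z + v) = pow (z + v) (- s)"
      by (simp add: f_def)
    also have "(\<Sum>i\<le>N. f s i z * (z + v - z) ^ i / fact i) =
                 (\<Sum>k\<le>N. ((- s) gchoose k) * v ^ k * pow z (- s - of_nat k))"
      by (intro sum.cong refl) (simp add: f_def)
    finally show ?thesis by (simp add: Taylor_remainder_def field_simps)
  qed
  show ?thesis
    by (intro exI[of _ "fact (Suc N) * G * C * norm v ^ Suc N / fact N"] ballI allI impI) (rule bound)
qed

end

abbreviation right_half_plane :: "real \<Rightarrow> complex set" where
  "right_half_plane x \<equiv> {s. x < Re s}"

lemma open_right_half_plane: "open (right_half_plane x)"
  by (intro open_Collect_less continuous_intros)

lemma right_half_plane_nonempty: "right_half_plane x \<noteq> {}"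
proof -
  have "of_real (x + 1) \<in> right_half_plane x" by simp
  thus ?thesis by blast
qed

lemma connected_right_half_plane: "connected (right_half_plane x)"
  using convex_halfspace_Re_gt[of x] by (simp add: convex_connected)

lemma holomorphic_shift_right_half_plane:
  assumes "F holomorphic_on right_half_plane x" "x \<le> y + Re c"
  shows   "(\<lambda>u. F (u + c)) holomorphic_on right_half_plane y"
proof -
  have "(F \<circ> (\<lambda>u. u + c)) holomorphic_on right_half_plane y"
    using assms by (intro holomorphic_on_compose_gen[OF _ assms(1)] holomorphic_intros) auto
  thus ?thesis by (simp add: o_def)
qed

lemma has_sum_finite_sum:
  fixes f :: "'a \<Rightarrow> 'b \<Rightarrow> complex"
  assumes "\<And>k. k \<in> A \<Longrightarrow> (f k has_sum S k) B"
  shows   "((\<lambda>m. \<Sum>k\<in>A. f k m) has_sum (\<Sum>k\<in>A. S k)) B"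
  using assms by (induction A rule: infinite_finite_induct) (auto intro: has_sum_add)

lemma summable_on_of_decay:
  fixes f :: "(nat \<Rightarrow> nat) \<Rightarrow> complex"
  assumes "\<tau> > real r" "\<And>m. m \<in> multi_indices r \<Longrightarrow> norm (f m) \<le> K * index_size r m powr (- \<tau>)"
  shows   "f summable_on multi_indices r"
proof (rule abs_summable_summable)
  show "Infinite_Sum.abs_summable_on f (multi_indices r)"
    by (rule summable_on_comparison_test
              [OF summable_on_cmult_right[OF summable_on_multi_indices[OF assms(1)], of K]])
       (use assms(2) in auto)
qed

text \<open>
  The common reason why the zeta series (\<open>d = 0\<close>) and the sums of Taylor remainders
  (\<open>d = N + 1\<close>) are holomorphic: terms that decay like the power \<open>-(Re s + d)\<close> of the index size can
  be summed for \<open>Re s + d > r\<close>.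
\<close>
lemma holomorphic_infsum_of_decay:
  fixes g :: "(nat \<Rightarrow> nat) \<Rightarrow> complex \<Rightarrow> complex" and d :: real
  assumes d: "0 \<le> d"
  assumes holo: "\<And>m. m \<in> multi_indices r \<Longrightarrow> g m holomorphic_on right_half_plane (real r - d)"
  assumes decay: "\<And>\<tau> T. 0 \<le> \<tau> \<Longrightarrow> \<exists>K. \<forall>m\<in>multi_indices r. \<forall>s. \<tau> \<le> Re s + d \<longrightarrow> norm s \<le> T \<longrightarrow>
                    norm (g m s) \<le> K * index_size r m powr (- \<tau>)"
  shows "(\<lambda>s. \<Sum>\<^sub>\<infinity>m\<in>multi_indices r. g m s) holomorphic_on right_half_plane (real r - d)"
proof (rule holomorphic_infsum[OF open_right_half_plane holo])
  fix s0 assume s0: "s0 \<in> right_half_plane (real r - d)"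
  \<comment> \<open>An exponent strictly between \<open>r\<close> and \<open>Re s0 + d\<close>: still summable, and still available on a
      whole disc around \<open>s0\<close>.\<close>
  define \<tau> where "\<tau> = (real r + (Re s0 + d)) / 2"
  define \<epsilon> where "\<epsilon> = Re s0 + d - \<tau>"
  have \<tau>: "\<tau> > real r" "\<tau> \<ge> 0" and \<epsilon>: "\<epsilon> > 0"
    using s0 by (auto simp: \<tau>_def \<epsilon>_def field_simps)
  obtain K where K: "\<And>m s. m \<in> multi_indices r \<Longrightarrow> \<tau> \<le> Re s + d \<Longrightarrow> norm s \<le> norm s0 + \<epsilon> \<Longrightarrow>
                    norm (g m s) \<le> K * index_size r m powr (- \<tau>)"
    using decay[OF \<tau>(2), of "norm s0 + \<epsilon>"] by blast
  have "norm (g m s) \<le> K * index_size r m powr (- \<tau>)"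
    if "m \<in> multi_indices r" "dist s0 s \<le> \<epsilon>" for m s
  proof (rule K[OF that(1)])
    have "Re (s0 - s) \<le> \<epsilon>"
      using that(2) complex_Re_le_cmod[of "s0 - s"] by (simp add: dist_norm)
    thus "\<tau> \<le> Re s + d" by (simp add: \<epsilon>_def)
    show "norm s \<le> norm s0 + \<epsilon>"
      using that(2) norm_triangle_ineq2[of s s0] by (simp add: dist_norm norm_minus_commute)
  qed
  thus "\<exists>\<epsilon>>0. \<exists>M. M summable_on multi_indices r \<and>
          (\<forall>m\<in>multi_indices r. \<forall>s\<in>right_half_plane (real r - d). dist s0 s \<le> \<epsilon> \<longrightarrow> norm (g m s) \<le> M m)"
    using \<epsilon> summable_on_cmult_right[OF summable_on_multi_indices[OF \<tau>(1)], of K]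
    by (intro exI[of _ \<epsilon>] conjI exI[of _ "\<lambda>m. K * index_size r m powr (- \<tau>)"]) auto
qed

section \<open>The recurrence between Barnes series\<close>

text \<open>
  Split the indices according to whether the last one is zero; the nonzero case is the image of
  the whole index set under raising the last index by one.
\<close>
lemma infsum_multi_indices_Suc:
  fixes f :: "(nat \<Rightarrow> nat) \<Rightarrow> complex"
  assumes "f summable_on multi_indices (Suc r)"
  shows   "infsum f (multi_indices (Suc r)) =
             (\<Sum>\<^sub>\<infinity>m\<in>multi_indices r. f (m(Suc r := 0))) +
             (\<Sum>\<^sub>\<infinity>m\<in>multi_indices (Suc r). f (m(Suc r := Suc (m (Suc r)))))"
proof -
  define A where "A = {m \<in> multi_indices (Suc r). m (Suc r) = 0}"
  define B where "B = {m \<in> multi_indices (Suc r). m (Suc r) \<noteq> 0}"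
  have AB: "multi_indices (Suc r) = A \<union> B" "A \<inter> B = {}"
    by (auto simp: A_def B_def)
  have "infsum f (multi_indices (Suc r)) = infsum f A + infsum f B"
    unfolding AB(1)
    by (intro infsum_Un_disjoint AB(2) summable_on_subset_banach[OF assms]) (auto simp: AB(1))
  also have "infsum f A = (\<Sum>\<^sub>\<infinity>m\<in>multi_indices r. f (m(Suc r := 0)))"
  proof (rule infsum_reindex_bij_betw[symmetric], rule bij_betwI)
    show "(\<lambda>m. m(Suc r := 0)) \<in> multi_indices r \<rightarrow> A"
      by (auto simp: A_def multi_indices_def PiE_iff extensional_def)
    show "(\<lambda>m. m(Suc r := undefined)) \<in> A \<rightarrow> multi_indices r"
      by (auto simp: A_def multi_indices_def PiE_iff extensional_def)
  qed (auto simp: A_def multi_indices_def PiE_iff extensional_def fun_eq_iff)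
  also have "infsum f B = (\<Sum>\<^sub>\<infinity>m\<in>multi_indices (Suc r). f (m(Suc r := Suc (m (Suc r)))))"
  proof (rule infsum_reindex_bij_betw[symmetric], rule bij_betwI)
    show "(\<lambda>m. m(Suc r := Suc (m (Suc r)))) \<in> multi_indices (Suc r) \<rightarrow> B"
      by (auto simp: B_def multi_indices_def PiE_iff extensional_def)
    show "(\<lambda>m. m(Suc r := m (Suc r) - 1)) \<in> B \<rightarrow> multi_indices (Suc r)"
      by (auto simp: B_def multi_indices_def PiE_iff extensional_def)
  qed (auto simp: B_def fun_eq_iff)
  finally show ?thesis .
qed

lemma lattice_point_upd_0: "lattice_point (Suc r) a w (m(Suc r := 0)) = lattice_point r a w m"
  by (auto simp: lattice_point_def intro!: sum.cong)

lemma lattice_point_upd_Suc: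
  "lattice_point (Suc r) a w (m(Suc r := Suc (m (Suc r)))) = lattice_point (Suc r) a w m + w (Suc r)"
proof -
  have "(\<Sum>i=1..r. of_nat ((m(Suc r := Suc (m (Suc r)))) i) * w i) = (\<Sum>i=1..r. of_nat (m i) * w i)"
    by (intro sum.cong) auto
  thus ?thesis by (simp add: lattice_point_def algebra_simps)
qed

context half_plane_log
begin

lemma lattice_pow_decay:
  assumes "a \<in> H" "\<forall>i\<in>{1..r}. w i \<in> H" "0 \<le> \<tau>"
  shows "\<exists>K. \<forall>m\<in>multi_indices r. \<forall>s. \<tau> \<le> Re s \<longrightarrow> norm s \<le> T \<longrightarrow>
           norm (pow (lattice_point r a w m) (- s)) \<le> K * index_size r m powr (- \<tau>)"
proof -
  obtain c where c: "0 < c" "c \<le> 1" "\<And>m. c * index_size r m \<le> ht (lattice_point r a w m)"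
    using lattice_point_height[OF assms(1,2)] by blast
  have "c * index_size r m \<le> norm (lattice_point r a w m)" for m
    using c(3)[of m] tilted_height_le_norm[of \<phi>] by (meson order_trans)
  thus ?thesis
    using pow_bound[OF c(1,2) assms(3), of T] lattice_point_in_H[OF assms(1,2)] index_size_ge_1[of r]
    by meson
qed

lemma lattice_remainder_decay:
  assumes "a \<in> H" "\<forall>i\<in>{1..r}. w i \<in> H" "v \<in> H" "0 \<le> \<tau>"
  shows "\<exists>K. \<forall>m\<in>multi_indices r. \<forall>s. \<tau> \<le> Re s + (real N + 1) \<longrightarrow> norm s \<le> T \<longrightarrow>
           norm (Taylor_remainder v N (lattice_point r a w m) s) \<le> K * index_size r m powr (- \<tau>)"
proof -
  obtain c where c: "0 < c" "c \<le> 1" "\<And>m. c * index_size r m \<le> ht (lattice_point r a w m)"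
    using lattice_point_height[OF assms(1,2)] by blast
  show ?thesis
    using Taylor_remainder_bound[OF c(1,2) assms(4,3), of N T] lattice_point_in_H[OF assms(1,2)] 
          index_size_ge_1[of r] c(3) unfolding add.assoc[symmetric]
    by meson
qed

lemma barnes_series_summable:
  assumes "a \<in> H" "\<forall>i\<in>{1..r}. w i \<in> H" "Re s > real r"
  shows   "(\<lambda>m. pow (lattice_point r a w m) (- s)) summable_on multi_indices r"
proof -
  have "0 \<le> Re s" using assms(3) by simp
  from lattice_pow_decay[OF assms(1,2) this, of "norm s"] obtain K where
    "\<And>m. m \<in> multi_indices r \<Longrightarrow> norm (pow (lattice_point r a w m) (- s)) \<le> K * index_size r m powr (- Re s)"
    by blast
  thus ?thesis by (rule summable_on_of_decay[OF assms(3)])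
qed

lemma barnes_series_holomorphic:
  assumes "a \<in> H" "\<forall>i\<in>{1..r}. w i \<in> H"
  shows   "barnes_series L r a w holomorphic_on right_half_plane (real r)"
proof -
  have "(\<lambda>s. \<Sum>\<^sub>\<infinity>m\<in>multi_indices r. pow (lattice_point r a w m) (- s)) 
          holomorphic_on right_half_plane (real r - 0)"
    using lattice_pow_decay[OF assms]
    by (intro holomorphic_infsum_of_decay pow_holomorphic holomorphic_intros) auto
  thus ?thesis by (simp add: barnes_series_eq[abs_def])
qed

lemma remainder_sum_holomorphic:
  assumes "a \<in> H" "\<forall>i\<in>{1..r}. w i \<in> H" "v \<in> H"
  shows   "(\<lambda>s. \<Sum>\<^sub>\<infinity>m\<in>multi_indices r. Taylor_remainder v N (lattice_point r a w m) s)
             holomorphic_on right_half_plane (real r - (real N + 1))"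
proof (intro holomorphic_infsum_of_decay)
  show "Taylor_remainder v N (lattice_point r a w m) holomorphic_on 
          right_half_plane (real r - (real N + 1))" for m
    unfolding Taylor_remainder_def
    by (intro holomorphic_intros pow_holomorphic gbinomial_uminus_holomorphic)
qed (use lattice_remainder_decay[OF assms] in auto)

text \<open>
  Both sides arise from the sum of the shifted terms \<open>(z + v)^-s\<close>: by splitting off the indices
  with vanishing last entry it is \<open>Z(s)\<close> minus the series of one dimension less, and by Taylor's
  formula it is \<open>Z(s) - s v Z(s + 1)\<close> plus the remaining terms.
\<close>
lemma barnes_series_recurrence:
  assumes a: "a \<in> H" and w: "\<forall>i\<in>{1..Suc r}. w i \<in> H" and s: "Re s > real (Suc r)" and N: "N \<ge> 1"
  defines "Z \<equiv> barnes_series L (Suc r) a w" and "v \<equiv> w (Suc r)"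
  shows   "s * v * Z (s + 1) =
             barnes_series L r a w s +
             (\<Sum>\<^sub>\<infinity>m\<in>multi_indices (Suc r). Taylor_remainder v N (lattice_point (Suc r) a w m) s) +
             (\<Sum>k=2..N. ((- s) gchoose k) * v ^ k * Z (s + of_nat k))"
proof -
  let ?X = "multi_indices (Suc r)" and ?z = "lattice_point (Suc r) a w"
  let ?R = "\<lambda>m. Taylor_remainder v N (?z m) s"
  have v: "v \<in> H" using w by (simp add: v_def)
  have "(\<lambda>m. pow (?z m) (- s)) summable_on ?X"
    by (rule barnes_series_summable[OF a w s])
  from infsum_multi_indices_Suc[OF this]
  have 1: "(\<Sum>\<^sub>\<infinity>m\<in>?X. pow (?z m + v) (- s)) = Z s - barnes_series L r a w s"
    by (simp add: lattice_point_upd_0 lattice_point_upd_Suc Z_def v_def barnes_series_eq)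
  have Taylor: "((\<lambda>m. \<Sum>k\<le>N. ((- s) gchoose k) * v ^ k * pow (?z m) (- s - of_nat k)) has_sum
                  (\<Sum>k\<le>N. ((- s) gchoose k) * v ^ k * Z (s + of_nat k))) ?X"
  proof (intro has_sum_finite_sum has_sum_cmult_right)
    fix k
    have "(\<lambda>m. pow (?z m) (- (s + of_nat k))) summable_on ?X"
      using s by (intro barnes_series_summable[OF a w]) auto
    thus "((\<lambda>m. pow (?z m) (- s - of_nat k)) has_sum Z (s + of_nat k)) ?X"
      by (simp add: Z_def barnes_series_eq algebra_simps)
  qed
  have "?R summable_on ?X"
  proof -
    have "0 \<le> Re s + (real N + 1)" using s by simp
    from lattice_remainder_decay[OF a w v this, of N "norm s"]
    obtain K where K: "\<And>m. m \<in> ?X \<Longrightarrow> norm (?R m) \<le> K * index_size (Suc r) m powr (- (Re s + (real N + 1)))"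
      by blast
    have "Re s + (real N + 1) > real (Suc r)" using s by simp
    thus ?thesis using K by (rule summable_on_of_decay)
  qed
  hence "((\<lambda>m. ?R m + (\<Sum>k\<le>N. ((- s) gchoose k) * v ^ k * pow (?z m) (- s - of_nat k))) has_sum
           (infsum ?R ?X + (\<Sum>k\<le>N. ((- s) gchoose k) * v ^ k * Z (s + of_nat k)))) ?X"
    by (intro has_sum_add Taylor) auto
  hence "(\<Sum>\<^sub>\<infinity>m\<in>?X. pow (?z m + v) (- s)) =
           infsum ?R ?X + (\<Sum>k\<le>N. ((- s) gchoose k) * v ^ k * Z (s + of_nat k))"
    by (simp add: Taylor_remainder_def infsumI)
  also have "{..N} = insert 0 (insert 1 {2..N})"
    using N by auto
  hence "(\<Sum>k\<le>N. ((- s) gchoose k) * v ^ k * Z (s + of_nat k)) =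
           Z s - s * v * Z (s + 1) + (\<Sum>k=2..N. ((- s) gchoose k) * v ^ k * Z (s + of_nat k))"
    by simp
  finally have "Z s - barnes_series L r a w s = infsum ?R ?X +
      (Z s - s * v * Z (s + 1) + (\<Sum>k=2..N. ((- s) gchoose k) * v ^ k * Z (s + of_nat k)))"
    by (rule trans[OF 1[symmetric]])
  moreover have "q = b + r + x" if "z - b = r + (z - q + x)" for q b r x z :: complex
    using that by (simp add: algebra_simps)
  ultimately show ?thesis by blast
qed

end

section \<open>Continuation to the whole plane\<close>

text \<open>
  Up to the constant in the binomial coefficient, both sides are the product of the same \<open>r + n\<close>
  consecutive factors starting with \<open>s - r\<close>. The last factor on the right is the one that clears the
  poles of the zeta function of dimension \<open>r + 1\<close> at \<open>s + n\<close>.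
\<close>
lemma pochhammer_gbinomial_cancel:
  fixes s :: complex
  assumes "n \<ge> 1"
  shows "pochhammer (s - of_nat r) r * ((- s) gchoose n) =
           (-1) ^ n / fact n * pochhammer (s - of_nat r) (n - 1) *
             pochhammer (s + of_nat n - of_nat (Suc r)) (Suc r)"
proof -
  have "pochhammer (s - of_nat r) r * pochhammer s n = pochhammer (s - of_nat r) (r + n)"
    by (simp add: pochhammer_product')
  also have "r + n = (n - 1) + Suc r"
    using assms by simp
  also have "pochhammer (s - of_nat r) \<dots> = pochhammer (s - of_nat r) (n - 1) *
               pochhammer (s - of_nat r + of_nat (n - 1)) (Suc r)"
    by (rule pochhammer_product')
  also have "s - of_nat r + of_nat (n - 1) = s + of_nat n - of_nat (Suc r)"
    using assms by (simp add: of_nat_diff)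
  finally show ?thesis
    by (simp add: gbinomial_pochhammer)
qed

context half_plane_log
begin

text \<open>
  Double induction, on \<open>r\<close> and on the number \<open>M\<close> of unit steps to the left. A step uses the
  recurrence multiplied by \<open>pochhammer (s - r) r\<close> and with \<open>N = M + 1\<close>, the least Taylor order for
  which the remainders can be summed on the new half-plane.
\<close>
lemma barnes_continuation_half_plane:
  assumes "a \<in> H" "\<forall>i\<in>{1..r}. w i \<in> H"
  shows   "\<exists>F. F holomorphic_on right_half_plane (real r - real M) \<and>
             (\<forall>s. Re s > real r \<longrightarrow> F s = pochhammer (s - of_nat r) r * barnes_series L r a w s)"
  using assms
proof (induction r arbitrary: M)
  case 0
  have "(\<lambda>s. pow a (- s)) holomorphic_on right_half_plane (real 0 - real M)"
    by (intro pow_holomorphic holomorphic_intros)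
  thus ?case
    by (intro exI[of _ "\<lambda>s. pow a (- s)"])
       (simp add: barnes_series_eq multi_indices_def lattice_point_def)
next
  case (Suc r)
  note a = Suc.prems(1) and w = Suc.prems(2)
  have w': "\<forall>i\<in>{1..r}. w i \<in> H" using w by auto
  define v where "v = w (Suc r)"
  have v: "v \<in> H" using w by (simp add: v_def)
  have v0: "v \<noteq> 0" by (rule nonzero[OF v])
  define Z where "Z = barnes_series L (Suc r) a w"
  have Z_holo: "(\<lambda>s. pochhammer (s - of_nat (Suc r)) (Suc r) * Z s) holomorphic_on
                  right_half_plane (real (Suc r))"
    unfolding Z_def by (intro holomorphic_intros barnes_series_holomorphic[OF a w])
  note IH = Suc.IH[OF a w']
  show ?case
  proof (induction M)
    case 0
    show ?case
      using Z_holo unfolding Z_def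
      by (intro exI[of _ "\<lambda>s. pochhammer (s - of_nat (Suc r)) (Suc r) * barnes_series L (Suc r) a w s"]) simp
  next
    case (Suc M)
    obtain F where F: "F holomorphic_on right_half_plane (real (Suc r) - real M)"
      "\<And>s. Re s > real (Suc r) \<Longrightarrow> F s = pochhammer (s - of_nat (Suc r)) (Suc r) * Z s"
      using Suc.IH unfolding Z_def by blast
    obtain G where G: "G holomorphic_on right_half_plane (real r - real (Suc M))"
      "\<And>s. Re s > real r \<Longrightarrow> G s = pochhammer (s - of_nat r) r * barnes_series L r a w s"
      using IH[of "Suc M"] by blast
    define N where "N = Suc M"
    have N: "N \<ge> 1" by (simp add: N_def)
    define Rem where "Rem = (\<lambda>s. \<Sum>\<^sub>\<infinity>m\<in>multi_indices (Suc r).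
                               Taylor_remainder v N (lattice_point (Suc r) a w m) s)"
    have Rem: "Rem holomorphic_on right_half_plane (real r - real (Suc M))"
    proof -
      have "real (Suc r) - (real N + 1) = real r - real (Suc M)"
        by (simp add: N_def)
      thus ?thesis
        using remainder_sum_holomorphic[OF a w v, of N] by (simp only: Rem_def)
    qed
    define c where "c = (\<lambda>k s. (-1) ^ k / fact k * pochhammer (s - of_nat r) (k - 1) * v ^ k :: complex)"
    define J where "J = (\<lambda>s. (G s + pochhammer (s - of_nat r) r * Rem s +
                              (\<Sum>k=2..N. c k s * F (s + of_nat k))) / v)"
    have J_holo: "J holomorphic_on right_half_plane (real r - real (Suc M))"
      unfolding J_def c_def using v0
      by (intro holomorphic_intros G(1) Rem holomorphic_shift_right_half_plane[OF F(1)]) auto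
    \<comment> \<open>The recurrence expresses the value at \<open>s + 1\<close>, so the continuation at \<open>u\<close> is \<open>J (u - 1)\<close>.\<close>
    define K where "K = (\<lambda>u. J (u + (- 1)))"
    have K_holo: "K holomorphic_on right_half_plane (real (Suc r) - real (Suc M))"
      unfolding K_def by (intro holomorphic_shift_right_half_plane[OF J_holo]) auto
    have J_eq: "J s = pochhammer (s + 1 - of_nat (Suc r)) (Suc r) * Z (s + 1)"
      if s: "Re s > real (Suc r)" for s
    proof -
      have term_eq: "pochhammer (s - of_nat r) r * (((- s) gchoose k) * v ^ k * Z (s + of_nat k)) =
                       c k s * F (s + of_nat k)" if k: "k \<in> {2..N}" for k
      proof -
        have "F (s + of_nat k) = pochhammer (s + of_nat k - of_nat (Suc r)) (Suc r) * Z (s + of_nat k)"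
          using s by (intro F(2)) simp
        moreover have "pochhammer (s - of_nat r) r * ((- s) gchoose k) =
           (-1) ^ k / fact k * pochhammer (s - of_nat r) (k - 1) *
             pochhammer (s + of_nat k - of_nat (Suc r)) (Suc r)"
          using k by (intro pochhammer_gbinomial_cancel) auto
        moreover have "pochhammer (s - of_nat r) r * (((- s) gchoose k) * v ^ k * Z (s + of_nat k)) =
                         pochhammer (s - of_nat r) r * ((- s) gchoose k) * (v ^ k * Z (s + of_nat k))"
          by (simp only: mult_ac)
        ultimately show ?thesis by (simp only: c_def) (simp only: mult_ac)
      qed
      have "pochhammer (s + 1 - of_nat (Suc r)) (Suc r) = pochhammer (s - of_nat r) r * s"
        by (simp add: pochhammer_rec')
      hence "v * (pochhammer (s + 1 - of_nat (Suc r)) (Suc r) * Z (s + 1)) =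
              pochhammer (s - of_nat r) r * (s * v * Z (s + 1))"
        by (simp only: mult_ac)
      also have "s * v * Z (s + 1) = barnes_series L r a w s + Rem s +
                   (\<Sum>k=2..N. ((- s) gchoose k) * v ^ k * Z (s + of_nat k))"
        unfolding Z_def v_def Rem_def by (rule barnes_series_recurrence[OF a w s N])
      also have "pochhammer (s - of_nat r) r * \<dots> =
                   G s + pochhammer (s - of_nat r) r * Rem s + (\<Sum>k=2..N. c k s * F (s + of_nat k))"
      proof -
        have "G s = pochhammer (s - of_nat r) r * barnes_series L r a w s"
          using s by (intro G(2)) simp
        moreover have "(\<Sum>k=2..N. c k s * F (s + of_nat k)) =
            (\<Sum>k=2..N. pochhammer (s - of_nat r) r * (((- s) gchoose k) * v ^ k * Z (s + of_nat k)))"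
          by (intro sum.cong refl term_eq[symmetric])
        ultimately show ?thesis by (simp only: distrib_left sum_distrib_left)
      qed
      also have "\<dots> = v * J s"
        using v0 by (simp add: J_def)
      finally show ?thesis using v0 by simp
    qed
    \<comment> \<open>The recurrence needs convergence at \<open>s = u - 1\<close> itself, which costs one unit; the identity
        theorem recovers the strip that is lost.\<close>
    have "K s = pochhammer (s - of_nat (Suc r)) (Suc r) * Z s" if s: "Re s > real (Suc r)" for s
    proof (rule analytic_continuation_open[of "right_half_plane (real (Suc r) + 1)" 
             "right_half_plane (real (Suc r))" K "\<lambda>s. pochhammer (s - of_nat (Suc r)) (Suc r) * Z s"])
      show "K s = pochhammer (s - of_nat (Suc r)) (Suc r) * Z s"
        if "s \<in> right_half_plane (real (Suc r) + 1)" for s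
        using J_eq[of "s - 1"] that by (simp add: K_def)
      show "K holomorphic_on right_half_plane (real (Suc r))"
        by (rule holomorphic_on_subset[OF K_holo]) auto
    qed (use s Z_holo right_half_plane_nonempty open_right_half_plane connected_right_half_plane in auto)
    with K_holo show ?case unfolding Z_def by blast
  qed
qed

lemma barnes_continuation_entire:
  assumes "a \<in> H" "\<forall>i\<in>{1..r}. w i \<in> H"
  shows   "\<exists>F. F holomorphic_on UNIV \<and>
             (\<forall>s. Re s > real r \<longrightarrow> F s = pochhammer (s - of_nat r) r * barnes_series L r a w s)"
proof -
  let ?S = "\<lambda>s. pochhammer (s - of_nat r) r * barnes_series L r a w s"
  obtain F where F: "\<And>M. F M holomorphic_on right_half_plane (real r - real M)"
      "\<And>M s. Re s > real r \<Longrightarrow> F M s = ?S s"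
    using barnes_continuation_half_plane[OF assms] by metis
  have agree: "F M s = F N s" if "Re s > real r - real M" "Re s > real r - real N" for M N s
  proof (rule analytic_continuation_open[of "right_half_plane (real r)"
                "right_half_plane (real r - real (min M N))" "F M" "F N"])
    show "F M holomorphic_on right_half_plane (real r - real (min M N))"
         "F N holomorphic_on right_half_plane (real r - real (min M N))"
      by (rule holomorphic_on_subset[OF F(1)]; force)+
  qed (use that F(2) right_half_plane_nonempty open_right_half_plane connected_right_half_plane in auto)
  \<comment> \<open>The continuations for different \<open>M\<close> agree by the identity theorem, so they can be glued by
      choosing \<open>M\<close> large enough for each \<open>s\<close>.\<close>
  define M where "M = (\<lambda>s. Suc (nat \<lceil>real r - Re s\<rceil>))"
  have M: "Re s > real r - real (M s)" for s
    by (simp add: M_def) linarith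
  define E where "E = (\<lambda>s. F (M s) s)"
  have "E field_differentiable (at s)" for s
  proof -
    have "E holomorphic_on right_half_plane (real r - real (M s))"
      using F(1)[of "M s"]
    proof (rule holomorphic_transform)
      show "F (M s) x = E x" if "x \<in> right_half_plane (real r - real (M s))" for x
        unfolding E_def by (rule agree[OF _ M]) (use that in simp)
    qed
    thus ?thesis
      using holomorphic_on_imp_differentiable_at[OF _ open_right_half_plane] M[of s] by blast
  qed
  moreover have "E s = ?S s" if "Re s > real r" for s
    using F(2) that by (simp add: E_def)
  ultimately show ?thesis
    by (auto simp: holomorphic_on_def)
qed

end

section \<open>Partial fractions and uniqueness of the continuation\<close>

text \<open>
  Adding a point \<open>x\<close>, the entire part \<open>E\<close> is replaced by its difference quotient at \<open>x\<close>, whose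
  singularity is removable, and each product of two simple fractions splits again.
\<close>
lemma entire_divided_by_simple_factors:
  fixes F :: "complex \<Rightarrow> complex"
  assumes "finite A" "F holomorphic_on UNIV"
  shows "\<exists>E c. E holomorphic_on UNIV \<and>
           (\<forall>s. s \<notin> A \<longrightarrow> F s / (\<Prod>q\<in>A. s - q) = E s + (\<Sum>q\<in>A. c q / (s - q)))"
  using assms(1)
proof (induction A)
  case empty
  show ?case using assms(2) by (intro exI[of _ F]) auto
next
  case (insert x A)
  obtain E c where E: "E holomorphic_on UNIV"
      and Ec: "\<And>s. s \<notin> A \<Longrightarrow> F s / (\<Prod>q\<in>A. s - q) = E s + (\<Sum>q\<in>A. c q / (s - q))"
    using insert.IH by blast
  define D where "D = (\<lambda>s. if s = x then deriv E x else (E s - E x) / (s - x))"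
  define c' where "c' = (\<lambda>q. if q = x then E x - (\<Sum>q\<in>A. c q / (q - x)) else c q / (q - x))"
  have "D holomorphic_on UNIV"
    unfolding D_def by (rule pole_lemma[OF E]) auto
  moreover have "F s / (\<Prod>q\<in>insert x A. s - q) = D s + (\<Sum>q\<in>insert x A. c' q / (s - q))"
    if s: "s \<notin> insert x A" for s
  proof -
    have sx: "s - x \<noteq> 0" using s by auto
    have split: "c q / (s - q) / (s - x) = c q / (q - x) / (s - q) - c q / (q - x) / (s - x)"
      if "q \<in> A" for q
    proof -
      have "s - q \<noteq> 0" "q - x \<noteq> 0" using that s insert.hyps by auto
      thus ?thesis using sx by (simp add: divide_simps) (simp add: algebra_simps)
    qed
    have "(\<Prod>q\<in>insert x A. s - q) = (\<Prod>q\<in>A. s - q) * (s - x)"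
      using insert.hyps by (simp add: mult.commute)
    hence "F s / (\<Prod>q\<in>insert x A. s - q) = F s / (\<Prod>q\<in>A. s - q) / (s - x)"
      by (simp only: divide_divide_eq_left)
    also have "\<dots> = (E s + (\<Sum>q\<in>A. c q / (s - q))) / (s - x)"
      using Ec[of s] s by simp
    also have "\<dots> = E s / (s - x) + (\<Sum>q\<in>A. c q / (s - q) / (s - x))"
      by (simp add: add_divide_distrib sum_divide_distrib)
    also have "(\<Sum>q\<in>A. c q / (s - q) / (s - x)) =
                 (\<Sum>q\<in>A. c q / (q - x) / (s - q)) - (\<Sum>q\<in>A. c q / (q - x)) / (s - x)"
      by (simp only: sum_subtractf[symmetric] sum_divide_distrib) (intro sum.cong refl split)
    also have "(\<Sum>q\<in>A. c q / (q - x) / (s - q)) = (\<Sum>q\<in>A. c' q / (s - q))"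
      using insert.hyps by (intro sum.cong) (auto simp: c'_def)
    also have "E s / (s - x) + ((\<Sum>q\<in>A. c' q / (s - q)) - (\<Sum>q\<in>A. c q / (q - x)) / (s - x)) =
                 D s + (c' x / (s - x) + (\<Sum>q\<in>A. c' q / (s - q)))"
      using s by (simp add: D_def c'_def diff_divide_distrib)
    finally show ?thesis
      using insert.hyps by simp
  qed
  ultimately show ?case by blast
qed

text \<open>
  The identity theorem; the normalisation at poles upgrades agreement off a sparse set to
  agreement of the total functions. This is what makes the definite description in the definition
  of the zeta function meaningful.
\<close>
lemma nicely_meromorphic_eqI:
  assumes f: "f nicely_meromorphic_on UNIV" and g: "g nicely_meromorphic_on UNIV"
  assumes U: "open U" "U \<noteq> {}" and eq: "\<And>s. s \<in> U \<Longrightarrow> f s = g s"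
  shows "f = g"
proof -
  obtain u where u: "u \<in> U" using U by blast
  have "(\<lambda>s. f s - g s) meromorphic_on UNIV"
    using f g by (intro meromorphic_intros) (auto simp: nicely_meromorphic_on_def)
  from meromorphic_imp_constant_or_avoid[OF this open_UNIV connected_UNIV, of 0]
  have ev: "\<forall>\<^sub>F s in at z. f s = g s" for z
  proof
    assume "\<forall>\<^sub>\<approx>s. f s - g s = 0"
    thus ?thesis by (auto simp: eventually_cosparse_open_eq elim: eventually_mono)
  next
    assume "\<forall>\<^sub>\<approx>s. f s - g s \<noteq> 0"
    hence "\<forall>\<^sub>F s in at u. f s - g s \<noteq> 0"
      by (auto simp: eventually_cosparse_open_eq)
    moreover have "\<forall>\<^sub>F s in at u. s \<in> U"
      using U u by (intro eventually_at_in_open') 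
    ultimately have "\<forall>\<^sub>F s in at u. False"
      by eventually_elim (use eq in auto)
    thus ?thesis by simp
  qed
  show ?thesis
  proof
    fix z
    have pole: "is_pole f z \<longleftrightarrow> is_pole g z"
      by (rule is_pole_cong[OF ev refl])
    show "f z = g z"
    proof (cases "is_pole f z")
      case True
      hence "\<not> f \<midarrow>z\<rightarrow> f z" "\<not> g \<midarrow>z\<rightarrow> g z"
        using pole by (auto simp: is_pole_def dest: not_tendsto_and_filterlim_at_infinity[rotated -1] )
      hence "f z = 0" "g z = 0"
        using f g unfolding nicely_meromorphic_on_def by blast+
      thus ?thesis by simp
    next
      case False
      hence "f \<midarrow>z\<rightarrow> f z" "g \<midarrow>z\<rightarrow> g z"
        using f g pole by (auto simp: nicely_meromorphic_on_def)
      moreover from this(1) have "g \<midarrow>z\<rightarrow> f z"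
        using tendsto_cong[OF ev] by blast
      ultimately show ?thesis using LIM_unique by blast
    qed
  qed
qed

lemma pochhammer_eq_prod_roots:
  "pochhammer (s - of_nat r) r = (\<Prod>q\<in>of_nat ` {1..r}. s - q)" for s :: complex
proof -
  have "(\<Prod>q\<in>of_nat ` {1..r}. s - q) = (\<Prod>q=1..r. s - of_nat q)"
    by (subst prod.reindex) (auto simp: inj_on_def)
  also have "\<dots> = (\<Prod>i=0..<r. s - of_nat r + of_nat i)"
    by (rule prod.reindex_bij_witness[of _ "\<lambda>i. r - i" "\<lambda>q. r - q"]) (auto simp: of_nat_diff)
  finally show ?thesis by (simp add: pochhammer_prod)
qed

text \<open>
  Dividing the entire continuation by its polynomial factor gives the right-hand side on a
  right half-plane, and after removing singularities it has the two properties that determine the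
  zeta function. At the points \<open>1, \<dots>, r\<close> nothing is claimed, since the value there depends on whether
  the residue vanishes.
\<close>
lemma (in half_plane_log) barnes_zeta_partial_fractions:
  assumes "a \<in> H" "\<forall>i\<in>{1..r}. w i \<in> H"
  shows "\<exists>E c. E holomorphic_on UNIV \<and>
           (\<forall>s. s \<notin> of_nat ` {1..r} \<longrightarrow>
              barnes_zeta L r a w s = E s + (\<Sum>q=1..r. c q / (s - of_nat q)))"
proof -
  let ?A = "of_nat ` {1..r} :: complex set"
  obtain F where F: "F holomorphic_on UNIV"
    "\<And>s. Re s > real r \<Longrightarrow> F s = pochhammer (s - of_nat r) r * barnes_series L r a w s"
    using barnes_continuation_entire[OF assms] by blast
  obtain E c where E: "E holomorphic_on UNIV"
    and Ec: "\<And>s. s \<notin> ?A \<Longrightarrow> F s / (\<Prod>q\<in>?A. s - q) = E s + (\<Sum>q\<in>?A. c q / (s - q))"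
    using entire_divided_by_simple_factors[OF _ F(1), of ?A] by blast
  define Z where "Z = (\<lambda>s. E s + (\<Sum>q\<in>?A. c q / (s - q)))"
  have an: "Z analytic_on {s}" if "s \<notin> ?A" for s
    unfolding Z_def using that
    by (intro analytic_intros holomorphic_on_imp_analytic_at[OF E]) auto
  have "Z meromorphic_on UNIV"
    unfolding Z_def using E
    by (intro meromorphic_intros analytic_on_imp_meromorphic_on)
       (auto simp: analytic_on_open)
  hence nice: "remove_sings Z nicely_meromorphic_on UNIV"
    by (rule remove_sings_nicely_meromorphic)
  have series: "remove_sings Z s = barnes_series L r a w s" if s: "Re s > real r" for s
  proof -
    have sA: "s \<notin> ?A" using s by auto
    hence "(\<Prod>q\<in>?A. s - q) \<noteq> 0" by auto
    moreover have "Z s = F s / (\<Prod>q\<in>?A. s - q)"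
      using Ec[OF sA] by (simp add: Z_def)
    ultimately have "Z s = barnes_series L r a w s"
      using F(2)[OF s] by (simp add: pochhammer_eq_prod_roots)
    thus ?thesis using an[OF sA] by simp
  qed
  have "barnes_zeta L r a w = remove_sings Z"
    unfolding barnes_zeta_def
  proof (rule the_equality)
    fix Y assume Y: "Y nicely_meromorphic_on UNIV \<and> (\<forall>s. real r < Re s \<longrightarrow> Y s = barnes_series L r a w s)"
    show "Y = remove_sings Z"
      by (rule nicely_meromorphic_eqI[OF _ nice open_right_half_plane right_half_plane_nonempty])
         (use Y series in auto)
  qed (use nice series in auto)
  moreover have "remove_sings Z s = E s + (\<Sum>q=1..r. c (of_nat q) / (s - of_nat q))" if "s \<notin> ?A" for s
  proof -
    have "(\<Sum>q\<in>?A. c q / (s - q)) = (\<Sum>q=1..r. c (of_nat q) / (s - of_nat q))"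
      by (subst sum.reindex) (auto simp: inj_on_def)
    thus ?thesis using an[OF that] by (simp add: Z_def)
  qed
  ultimately show ?thesis
    using E by (intro exI[of _ E] exI[of _ "\<lambda>q. c (of_nat q)"]) auto
qed

section \<open>Laurent coefficients\<close>

lemma has_fps_expansion_simple_fraction:
  fixes d :: complex
  assumes "d \<noteq> 0"
  shows   "(\<lambda>x. c / (x - d)) has_fps_expansion Abs_fps (\<lambda>k. - c / d ^ Suc k)"
proof -
  define G where "G = Abs_fps (\<lambda>k. - 1 / d ^ Suc k)"
  have "(fps_X - fps_const d) * G = 1"
  proof (rule fps_ext)
    fix n show "fps_nth ((fps_X - fps_const d) * G) n = fps_nth 1 n"
      using assms by (cases n) (auto simp: G_def left_diff_distrib)
  qed
  hence "inverse (fps_X - fps_const d) = G"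
    by (rule fps_inverse_unique)
  moreover have "(\<lambda>x. c * inverse (x - d)) has_fps_expansion
                   (fps_const c * inverse (fps_X - fps_const d))"
    using assms by (intro fps_expansion_intros) auto
  moreover have "fps_const c * G = Abs_fps (\<lambda>k. - c / d ^ Suc k)"
    by (rule fps_ext) (simp add: G_def)
  ultimately show ?thesis by (simp add: field_simps)
qed

text \<open>
  Around \<open>j\<close> each fraction with \<open>q \<noteq> j\<close> is a geometric series with ratio
  \<open>(s - j) / (q - j)\<close>.
\<close>
lemma laurent_coefficients_of_simple_poles:
  fixes Z :: "complex \<Rightarrow> complex"
  assumes E: "E holomorphic_on UNIV" and j: "j \<in> {1..r}"
  assumes Z: "\<And>s. s \<notin> of_nat ` {1..r} \<Longrightarrow> Z s = E s + (\<Sum>q=1..r. c q / (s - of_nat q))"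
  shows   "residue Z (of_nat j) = c j"
    and   "fls_nth (laurent_expansion Z (of_nat j)) (int k) =
             fps_nth (fps_expansion E (of_nat j)) k -
               (\<Sum>q\<in>{1..r}-{j}. c q / (of_nat q - of_nat j) ^ Suc k)"
proof -
  let ?B = "{1..r} - {j}"
  define G where "G = fps_expansion E (of_nat j) +
                        (\<Sum>q\<in>?B. Abs_fps (\<lambda>k. - c q / (of_nat q - of_nat j) ^ Suc k))"
  have "(\<lambda>x. E (of_nat j + x)) has_fps_expansion fps_expansion E (of_nat j)"
    by (intro analytic_at_imp_has_fps_expansion holomorphic_on_imp_analytic_at[OF E]) auto
  hence "(\<lambda>x. E (of_nat j + x) + (\<Sum>q\<in>?B. c q / (x - (of_nat q - of_nat j)))) has_fps_expansion G"
    unfolding G_def by (intro fps_expansion_intros has_fps_expansion_simple_fraction) auto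
  hence exp: "(\<lambda>x. c j * x powi (- 1) + (E (of_nat j + x) + (\<Sum>q\<in>?B. c q / (x - (of_nat q - of_nat j)))))
          has_laurent_expansion (fls_const (c j) * fls_X_intpow (- 1) + fps_to_fls G)"
    by (intro laurent_expansion_intros has_laurent_expansion_fps)
  have "\<forall>\<^sub>F s in at (of_nat j :: complex). s \<notin> of_nat ` {1..r}"
    using islimpt_finite[of "of_nat ` {1..r} :: complex set" "of_nat j"]
    by (simp add: islimpt_iff_eventually)
  hence "\<forall>\<^sub>F x in at 0. of_nat j + x \<notin> (of_nat ` {1..r} :: complex set)"
    by (simp add: at_to_0[of "of_nat j"] eventually_filtermap add.commute)
  hence "\<forall>\<^sub>F x in at 0. Z (of_nat j + x) = 
           c j * x powi (- 1) + (E (of_nat j + x) + (\<Sum>q\<in>?B. c q / (x - (of_nat q - of_nat j))))"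
  proof eventually_elim
    case (elim x)
    have "Z (of_nat j + x) = E (of_nat j + x) + (\<Sum>q=1..r. c q / (of_nat j + x - of_nat q))"
      by (rule Z[OF elim])
    also have "(\<Sum>q=1..r. c q / (of_nat j + x - of_nat q)) =
                 c j / x + (\<Sum>q\<in>?B. c q / (of_nat j + x - of_nat q))"
      using j by (subst sum.remove[of _ j]) auto
    finally show ?case by (simp add: algebra_simps power_int_minus divide_inverse)
  qed
  from has_laurent_expansion_cong[OF this refl] exp
  have L: "(\<lambda>x. Z (of_nat j + x)) has_laurent_expansion (fls_const (c j) * fls_X_intpow (- 1) + fps_to_fls G)"
    by blast
  show "residue Z (of_nat j) = c j"
    by (simp add: has_laurent_expansion_residue[OF L])
  show "fls_nth (laurent_expansion Z (of_nat j)) (int k) =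
             fps_nth (fps_expansion E (of_nat j)) k -
               (\<Sum>q\<in>{1..r}-{j}. c q / (of_nat q - of_nat j) ^ Suc k)"
    by (simp add: laurent_expansion_eqI[OF L] G_def fps_sum_nth sum_negf)
qed

lemma entire_Taylor_coefficients_bound:
  assumes "E holomorphic_on UNIV" "R > 0"
  shows   "\<exists>B. \<forall>k. norm (fps_nth (fps_expansion E z) k) \<le> B / R ^ k"
proof -
  have cont: "continuous_on A E" for A
    using assms(1) holomorphic_on_imp_continuous_on holomorphic_on_subset by blast
  have "compact (E ` sphere z R)"
    by (intro compact_continuous_image cont compact_sphere)
  then obtain B where B: "\<forall>x\<in>sphere z R. norm (E x) \<le> B"
    by (auto dest!: compact_imp_bounded simp: bounded_iff)
  have "norm ((deriv ^^ k) E z) \<le> fact k * B / R ^ k" for k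
    using B assms by (intro Cauchy_inequality cont holomorphic_on_subset[OF assms(1)]) 
                     (auto simp: dist_norm)
  hence "norm ((deriv ^^ k) E z) / fact k \<le> fact k * B / R ^ k / fact k" for k
    by (intro divide_right_mono) auto
  hence "norm (fps_nth (fps_expansion E z) k) \<le> B / R ^ k" for k
    by (simp add: fps_expansion_def norm_divide)
  thus ?thesis by blast
qed


text \<open>
  If \<open>g\<close> converges, then its even and odd subsequences have the same limit, which forces
  \<open>A = -A\<close>.
\<close>
lemma limits_of_alternating_sequence:
  fixes g :: "nat \<Rightarrow> complex"
  assumes small: "(\<lambda>k. g k - ((-1) ^ k * A - B)) \<longlonglongrightarrow> 0"
  shows "(\<lambda>n. g (2 * n)) \<longlonglongrightarrow> A - B"
    and "(\<lambda>n. g (2 * n + 1)) \<longlonglongrightarrow> - A - B"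
    and "convergent g \<longleftrightarrow> A = 0"
    and "A = 0 \<longrightarrow> g \<longlonglongrightarrow> - B"
proof -
  have subseq: "strict_mono (\<lambda>n::nat. 2 * n)" "strict_mono (\<lambda>n::nat. 2 * n + 1)"
    by (auto simp: strict_mono_def)
  have "(\<lambda>n. g (2 * n) - (A - B)) \<longlonglongrightarrow> 0"
    using LIMSEQ_subseq_LIMSEQ[OF small subseq(1)] by (simp add: o_def)
  thus even: "(\<lambda>n. g (2 * n)) \<longlonglongrightarrow> A - B"
    using LIM_zero_iff by blast
  have "(\<lambda>n. g (2 * n + 1) - (- A - B)) \<longlonglongrightarrow> 0"
    using LIMSEQ_subseq_LIMSEQ[OF small subseq(2)] by (simp add: o_def)
  thus odd: "(\<lambda>n. g (2 * n + 1)) \<longlonglongrightarrow> - A - B"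
    using LIM_zero_iff by blast
  show lim: "A = 0 \<longrightarrow> g \<longlonglongrightarrow> - B"
  proof
    assume "A = 0"
    hence "(\<lambda>k. g k - (- B)) \<longlonglongrightarrow> 0"
      using small by simp
    thus "g \<longlonglongrightarrow> - B"
      using LIM_zero_iff by blast
  qed
  show "convergent g \<longleftrightarrow> A = 0"
  proof
    assume "convergent g"
    then obtain l where l: "g \<longlonglongrightarrow> l"
      by (auto simp: convergent_def)
    have "l = A - B" "l = - A - B"
      using LIMSEQ_unique[OF LIMSEQ_subseq_LIMSEQ[OF l subseq(1)]] even
            LIMSEQ_unique[OF LIMSEQ_subseq_LIMSEQ[OF l subseq(2)]] odd
      by (auto simp: o_def)
    hence "A = - A" by simp
    thus "A = 0" by simp
  next
    assume "A = 0"
    thus "convergent g" using lim by (auto simp: convergent_def)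
  qed
qed

text \<open>
  Only the poles at distance at least 2 from \<open>j\<close>, collected in \<open>far\<close>, and the Taylor coefficients
  of the entire part enter the error term.
\<close>
theorem corollary3p4:
  fixes r j :: nat and \<phi> :: real and L :: "complex \<Rightarrow> complex"
    and a :: complex and w :: "nat \<Rightarrow> complex"
  assumes "r \<ge> 3" and "2 \<le> j" and "j \<le> r - 1"
    and "- pi < \<phi>" and "\<phi> < pi"
    and "holomorphic_log_on L (barnes_half_plane \<phi>)"
    and "a \<in> barnes_half_plane \<phi>"
    and "\<forall>i\<in>{1..r}. w i \<in> barnes_half_plane \<phi>"
  shows "(\<lambda>k. barnes_gamma L r a w j k
            - ((-1) ^ k * barnes_residue L r a w (j - 1) - barnes_residue L r a w (j + 1)))
           \<in> O[sequentially](\<lambda>k. 1 / 2 ^ k)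
    \<and> (\<lambda>n. barnes_gamma L r a w j (2 * n))
        \<longlonglongrightarrow> barnes_residue L r a w (j - 1) - barnes_residue L r a w (j + 1)
    \<and> (\<lambda>n. barnes_gamma L r a w j (2 * n + 1))
        \<longlonglongrightarrow> - barnes_residue L r a w (j - 1) - barnes_residue L r a w (j + 1)
    \<and> (convergent (barnes_gamma L r a w j) \<longleftrightarrow> barnes_residue L r a w (j - 1) = 0)
    \<and> (barnes_residue L r a w (j - 1) = 0
        \<longrightarrow> barnes_gamma L r a w j \<longlonglongrightarrow> - barnes_residue L r a w (j + 1))"
proof -
  interpret half_plane_log \<phi> L
    using assms by unfold_locales
  obtain E c where E: "E holomorphic_on UNIV"
    and Z: "\<And>s. s \<notin> of_nat ` {1..r} \<Longrightarrow>
                barnes_zeta L r a w s = E s + (\<Sum>q=1..r. c q / (s - of_nat q))"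
    using barnes_zeta_partial_fractions assms by metis
  have j: "j \<in> {1..r}" "j - 1 \<in> {1..r}" "j + 1 \<in> {1..r}"
    using assms by auto
  \<comment> \<open>The bounds on \<open>j\<close> place both neighbours among the points \<open>1, \<dots>, r\<close>, so their coefficients
      are the residues that appear in the main term.\<close>
  have residue: "barnes_residue L r a w q = c q" if "q \<in> {1..r}" for q
    using laurent_coefficients_of_simple_poles(1)[OF E that Z] by (simp add: barnes_residue_def)
  define e where "e = (\<lambda>k. fps_nth (fps_expansion E (of_nat j)) k)"
  obtain K where K: "\<And>k. norm (e k) \<le> K / 2 ^ k"
    using entire_Taylor_coefficients_bound[OF E, of 2 "of_nat j"] by (auto simp: e_def)
  define far where "far = {1..r} - {j - 1, j, j + 1}"
  have split: "{1..r} - {j} = insert (j - 1) (insert (j + 1) far)"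
      "j - 1 \<notin> insert (j + 1) far" "j + 1 \<notin> far" "finite far"
    using j assms by (auto simp: far_def)
  define \<delta> where "\<delta> = (\<lambda>k. barnes_gamma L r a w j k
            - ((-1) ^ k * barnes_residue L r a w (j - 1) - barnes_residue L r a w (j + 1)))"
  have \<delta>_eq: "\<delta> k = e k - (\<Sum>q\<in>far. c q / (of_nat q - of_nat j) ^ Suc k)" for k
  proof -
    have "barnes_gamma L r a w j k =
            e k - (\<Sum>q\<in>{1..r}-{j}. c q / (of_nat q - of_nat j) ^ Suc k)"
      using laurent_coefficients_of_simple_poles(2)[OF E j(1) Z]
      by (simp add: barnes_gamma_def e_def)
    also have "(\<Sum>q\<in>{1..r}-{j}. c q / (of_nat q - of_nat j) ^ Suc k) =
                 c (j - 1) / (- 1) ^ Suc k + c (j + 1) +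
                 (\<Sum>q\<in>far. c q / (of_nat q - of_nat j) ^ Suc k)"
      unfolding split(1) using split(2-) assms(2) by (simp add: of_nat_diff)
    also have "c (j - 1) / (- 1) ^ Suc k = - ((- 1) ^ k * c (j - 1))"
      by (cases "even k") auto
    finally show ?thesis
      unfolding \<delta>_def residue[OF j(2)] residue[OF j(3)] by (simp add: algebra_simps)
  qed
  have \<delta>_bound: "norm (\<delta> k) \<le> (K + (\<Sum>q\<in>far. norm (c q))) * (1 / 2 ^ k)" for k
  proof -
    have far_term: "norm (c q / (of_nat q - of_nat j) ^ Suc k) \<le> norm (c q) / 2 ^ k" if "q \<in> far" for q
    proof -
      have "(of_nat q - of_nat j :: complex) = of_int (int q - int j)" by simp
      moreover have "2 \<le> \<bar>int q - int j\<bar>"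
        using that by (auto simp: far_def)
      ultimately have "2 \<le> norm (of_nat q - of_nat j :: complex)"
        by (simp only: norm_of_int)
      hence "2 ^ Suc k \<le> norm (of_nat q - of_nat j :: complex) ^ Suc k"
        by (intro power_mono) auto
      moreover have "(2 :: real) ^ k \<le> 2 ^ Suc k" by simp
      ultimately have "2 ^ k \<le> norm (of_nat q - of_nat j :: complex) ^ Suc k"
        by linarith
      thus ?thesis
        unfolding norm_divide norm_power by (intro frac_le) auto
    qed
    have "norm (\<delta> k) \<le> norm (e k) + norm (\<Sum>q\<in>far. c q / (of_nat q - of_nat j) ^ Suc k)"
      unfolding \<delta>_eq by (rule norm_triangle_ineq4)
    also have "\<dots> \<le> K / 2 ^ k + (\<Sum>q\<in>far. norm (c q) / 2 ^ k)"
      using K by (intro add_mono sum_norm_le far_term) auto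
    finally show ?thesis
      by (simp add: add_divide_distrib sum_divide_distrib)
  qed
  have bigo: "\<delta> \<in> O(\<lambda>k. 1 / 2 ^ k)"
    by (rule bigoI[of _ "K + (\<Sum>q\<in>far. norm (c q))"]) (use \<delta>_bound in \<open>auto simp: norm_divide norm_power\<close>)
  have "(\<lambda>k. (K + (\<Sum>q\<in>far. norm (c q))) * (1 / 2 ^ k)) \<longlonglongrightarrow> 0"
    by (intro tendsto_mult_right_zero LIMSEQ_divide_realpow_zero) auto
  hence "\<delta> \<longlonglongrightarrow> 0"
    by (rule Lim_null_comparison[OF always_eventually, rotated]) (use \<delta>_bound in auto)
  note limits_of_alternating_sequence[OF this[unfolded \<delta>_def]]
  with bigo show ?thesis
    unfolding \<delta>_def by blast
qed

end
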